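(* Let $G$ be a finite simple undirected graph with vertex set $V$, $|V|=n$, edge set $E$, $|E|=m\ge 1$, clique number $\omega$ and vertex degrees $d_i$ ($i\in V$), and let $\mu$ be the largest eigenvalue of its adjacency matrix. Put $$\beta=\frac{\mu n}{2m},\qquad \nu=\frac{n\sum_{i\in V}d_i^2}{4m^2},\qquad \epsilon=\frac{n\sum_{ij\in E}\sqrt{d_id_j}}{2m^2}.$$ Then $$2m\le\frac{(\omega-1)n^2}{\omega\beta^2},$$ and moreover $$\text{(i)}\quad 2m\le\frac{(\omega-1)n^2}{\omega\nu}\qquad\text{and}\qquad\text{(ii)}\quad 2m\le\frac{(\omega-1)n^2}{\omega\epsilon^2}.$$
   Context: The clique number $\omega$ is the number of vertices of a largest complete subgraph of $G$. The sum over $ij\in E$ runs over each (unordered) edge once. The quantities $\beta,\nu,\epsilon$ are measures of irregularity of $G$, defined for graphs with at least one edge. *)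

theory Defs
  imports "HOL-Analysis.Analysis" "HOL-Library.Ramsey"
begin

text \<open>A finite simple undirected graph: its vertex set is the whole (arbitrary) finite type
  \<open>'v\<close>, so \<open>n = CARD('v)\<close>, and its edges are two-element sets of vertices.\<close>

definition simple_graph :: "'v::finite set set \<Rightarrow> bool" where
  "simple_graph E \<longleftrightarrow> (\<forall>e\<in>E. card e = 2)"

definition degree :: "'v::finite set set \<Rightarrow> 'v \<Rightarrow> nat" where
  "degree E i = card {e \<in> E. i \<in> e}"

definition clique_number :: "'v::finite set set \<Rightarrow> nat" where
  "clique_number E = Max {card K | K. clique K E}"

definition adjacency_matrix :: "'v::finite set set \<Rightarrow> real^'v^'v" where
  "adjacency_matrix E = (\<chi> i j. if {i, j} \<in> E then 1 else 0)"

definition eigenvalue :: "real^'v^'v \<Rightarrow> real \<Rightarrow> bool" where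
  "eigenvalue A c \<longleftrightarrow> (\<exists>x. x \<noteq> 0 \<and> A *v x = c *\<^sub>R x)"

text \<open>\<open>Max\<close> is meaningful here: the adjacency matrix is real symmetric, so its real eigenvalues
  are all its eigenvalues and form a finite nonempty set.\<close>

definition largest_eigenvalue :: "'v::finite set set \<Rightarrow> real" where
  "largest_eigenvalue E = Max {c. eigenvalue (adjacency_matrix E) c}"

definition beta :: "'v::finite set set \<Rightarrow> real" where
  "beta E = largest_eigenvalue E * real CARD('v) / (2 * real (card E))"

definition nu :: "'v::finite set set \<Rightarrow> real" where
  "nu E = real CARD('v) * (\<Sum>i\<in>UNIV. (real (degree E i))\<^sup>2) / (4 * (real (card E))\<^sup>2)"

text \<open>For an edge \<open>e = {i, j}\<close> the product over \<open>e\<close> is the product of the degrees of \<open>i\<close> and \<open>j\<close>;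
  each unordered edge contributes once.\<close>

definition epsilon :: "'v::finite set set \<Rightarrow> real" where
  "epsilon E = real CARD('v) * (\<Sum>e\<in>E. sqrt (\<Prod>i\<in>e. real (degree E i))) / (2 * (real (card E))\<^sup>2)"

end

theory Submission
  imports Defs
begin

text \<open>Put \<open>K\<^sup>2 = 2m(1 - 1/\<omega>)\<close>. Cauchy--Schwarz over the edges and the Motzkin--Straus
  inequality for the vector of squares \<open>x\<^sub>i\<^sup>2\<close> give \<open>\<bar>x \<bullet> Ax\<bar> \<le> K (x \<bullet> x)\<close> for the adjacency matrix \<open>A\<close>. Each of the three bounds is an instance:
  an eigenvector gives \<open>\<mu> \<le> K\<close>; since \<open>A\<close> is symmetric, its operator norm is at most \<open>K\<close>,
  and applying it to the all-ones vector bounds the sum of the squared degrees; the vector with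
  entries \<open>sqrt d\<^sub>i\<close> bounds \<open>\<epsilon>\<close>. As \<open>x / 0 = 0\<close>, one also needs \<open>\<beta>\<close>, \<open>\<nu>\<close> and \<open>\<epsilon>\<close> to be nonzero;
  for \<open>\<beta>\<close> this holds because the Rayleigh quotient of the all-ones vector is positive.\<close>

section \<open>Quadratic forms and eigenvalues of symmetric matrices\<close>

lemma inner_matrix_vector_sym:
  fixes A :: "real^'v^'v"
  assumes "transpose A = A"
  shows "x \<bullet> (A *v y) = y \<bullet> (A *v x)"
proof -
  have "x \<bullet> (A *v y) = (transpose A *v x) \<bullet> y"
    by (simp only: transpose_matrix_vector dot_lmul_matrix)
  then show ?thesis
    by (simp only: assms inner_commute)
qed

lemma inner_matrix_vector_sum:
  fixes A :: "real^'v^'v"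
  shows "x \<bullet> (A *v y) = (\<Sum>i\<in>UNIV. \<Sum>j\<in>UNIV. A $ i $ j * (x $ i * y $ j))"
  by (simp add: inner_vec_def matrix_vector_mult_def sum_distrib_left mult.left_commute)

text \<open>Symmetry merges the two cross terms. The expansion serves three times: for the first
  variation at a maximiser, for polarisation, and for shifting mass in the Motzkin--Straus
  argument.\<close>

lemma quadratic_form_add:
  fixes A :: "real^'v^'v"
  assumes "transpose A = A"
  shows "(x + t *\<^sub>R y) \<bullet> (A *v (x + t *\<^sub>R y)) =
    x \<bullet> (A *v x) + 2 * t * (y \<bullet> (A *v x)) + t\<^sup>2 * (y \<bullet> (A *v y))"
  using inner_matrix_vector_sym[OF assms, of x y]
  by (simp add: matrix_vector_right_distrib matrix_vector_mult_scaleR inner_add_left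
      inner_add_right power2_eq_square algebra_simps)

text \<open>For small \<open>t\<close> of sign opposite to \<open>b\<close> the linear term would
  outweigh the quadratic one. This is the first-order condition at an extremum, stated without
  derivatives.\<close>

lemma linear_coeff_zero_if_nonneg:
  fixes b c :: real
  assumes "\<And>t. 0 \<le> 2 * t * b + t\<^sup>2 * c"
  shows "b = 0"
proof (rule ccontr)
  assume "b \<noteq> 0"
  \<comment> \<open>The absolute value makes \<open>s * c < 2\<close> hold whatever the sign of
    \<open>c\<close>.\<close>
  define s where "s = 1 / (1 + \<bar>c\<bar>)"
  have s: "s > 0" "s * c < 2"
    unfolding s_def by (auto simp: field_simps)
  have "2 * (- s * b) * b + (- s * b)\<^sup>2 * c = s * b\<^sup>2 * (s * c - 2)"
    by (simp add: power2_eq_square algebra_simps)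
  also have "\<dots> < 0"
    using s \<open>b \<noteq> 0\<close> by (intro mult_pos_neg) auto
  finally show False
    using assms[of "- s * b"] by simp
qed

text \<open>A maximiser of the Rayleigh quotient is an eigenvector.\<close>

lemma eigenvalue_bounding_quadratic_form:
  fixes A :: "real^'v^'v"
  assumes sym: "transpose A = A"
  obtains c where "eigenvalue A c" and "\<And>x. x \<bullet> (A *v x) \<le> c * (x \<bullet> x)"
proof -
  define q where "q x = x \<bullet> (A *v x)" for x :: "real^'v"
  have "continuous_on (sphere 0 1) q"
    unfolding q_def
    by (intro continuous_on_inner continuous_on_id linear_continuous_on
        matrix_vector_mul_bounded_linear)
  moreover have "sphere 0 1 \<noteq> ({} :: (real^'v) set)"
    by simp
  ultimately obtain u where u: "norm u = 1" "\<And>x. norm x = 1 \<Longrightarrow> q x \<le> q u"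
    using continuous_attains_sup[of "sphere (0 :: real^'v) 1" q] by auto
  have bound: "q x \<le> q u * (x \<bullet> x)" for x
  proof (cases "x = 0")
    case False
    have "q x = (norm x)\<^sup>2 * q (x /\<^sub>R norm x)"
      using False by (simp add: q_def matrix_vector_mult_scaleR power2_eq_square field_simps)
    also have "\<dots> \<le> (norm x)\<^sup>2 * q u"
      using u(2)[of "x /\<^sub>R norm x"] False by (intro mult_left_mono) auto
    finally show ?thesis
      by (simp add: power2_norm_eq_inner mult.commute)
  qed (simp add: q_def)
  \<comment> \<open>The form \<open>q u * (x \<bullet> x) - q x\<close> is nonnegative and vanishes
    at \<open>u\<close>, so its linear coefficient at \<open>u\<close> vanishes in every direction
    \<open>y\<close>.\<close>
  have "y \<bullet> (q u *\<^sub>R u - A *v u) = 0" for y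
  proof (rule linear_coeff_zero_if_nonneg)
    fix t :: real
    have "0 \<le> q u * ((u + t *\<^sub>R y) \<bullet> (u + t *\<^sub>R y)) - q (u + t *\<^sub>R y)"
      using bound by simp
    also have "\<dots> = 2 * t * (y \<bullet> (q u *\<^sub>R u - A *v u)) + t\<^sup>2 * (q u * (y \<bullet> y) - q y)"
      using u(1) unfolding q_def quadratic_form_add[OF sym]
      by (simp add: norm_eq_1 inner_add_left inner_add_right inner_diff_right
          inner_commute[of u y] power2_eq_square algebra_simps)
    finally show "0 \<le> 2 * t * (y \<bullet> (q u *\<^sub>R u - A *v u)) + t\<^sup>2 * (q u * (y \<bullet> y) - q y)" .
  qed
  then have "q u *\<^sub>R u - A *v u = 0"
    using inner_eq_zero_iff by blast
  moreover have "u \<noteq> 0"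
    using u(1) by auto
  ultimately have "eigenvalue A (q u)"
    unfolding eigenvalue_def by (intro exI[of _ u]) simp
  then show thesis
    using bound that unfolding q_def by blast
qed

text \<open>Eigenvectors for distinct eigenvalues are orthogonal, hence independent, and an
  independent set in finite dimension is finite. This is what gives the \<open>Max\<close> in
  \<open>largest_eigenvalue\<close> its meaning.\<close>

lemma finite_eigenvalues:
  fixes A :: "real^'v^'v"
  assumes sym: "transpose A = A"
  shows "finite {c. eigenvalue A c}"
proof -
  obtain f where f: "\<And>c. eigenvalue A c \<Longrightarrow> f c \<noteq> 0 \<and> A *v f c = c *\<^sub>R f c"
    using choice[of "\<lambda>c x. eigenvalue A c \<longrightarrow> x \<noteq> 0 \<and> A *v x = c *\<^sub>R x"]
    unfolding eigenvalue_def by blast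
  have orth: "f c \<bullet> f d = 0" if "eigenvalue A c" "eigenvalue A d" "c \<noteq> d" for c d
  proof -
    have "d * (f c \<bullet> f d) = c * (f c \<bullet> f d)"
      using inner_matrix_vector_sym[OF sym, of "f c" "f d"] f that
      by (simp add: inner_commute)
    then show ?thesis
      using that by simp
  qed
  have inj: "inj_on f {c. eigenvalue A c}"
    using orth f by (intro inj_onI) (metis inner_eq_zero_iff mem_Collect_eq)
  have "pairwise orthogonal (f ` {c. eigenvalue A c})"
    using orth by (fastforce simp: pairwise_def orthogonal_def)
  moreover have "0 \<notin> f ` {c. eigenvalue A c}"
    using f by fastforce
  ultimately have "finite (f ` {c. eigenvalue A c})"
    by (intro independent_imp_finite pairwise_orthogonal_independent)
  then show ?thesis
    using inj by (rule finite_imageD)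
qed

text \<open>Polarisation writes \<open>4 * (y \<bullet> (A *v x))\<close> as the difference of the
  form at \<open>x + y\<close> and at \<open>x - y\<close>; the two-sided hypothesis bounds both
  terms, and the parallelogram law adds up the bounds.\<close>

lemma norm_matrix_vector_le_if_quadratic_form_le:
  fixes A :: "real^'v^'v"
  assumes sym: "transpose A = A" and K: "\<And>x. \<bar>x \<bullet> (A *v x)\<bar> \<le> K * (x \<bullet> x)"
  shows "norm (A *v x) \<le> K * norm x"
proof (cases "x = 0 \<or> A *v x = 0")
  case True
  have "0 \<le> K * (x \<bullet> x)"
    using K[of x] by linarith
  then have "0 \<le> K * norm x"
    by (cases "x = 0") (simp_all add: zero_le_mult_iff flip: power2_norm_eq_inner)
  with True show ?thesis
    by auto
next
  case False
  define s where "s = norm (A *v x) / norm x"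
  \<comment> \<open>The image of \<open>x\<close> rescaled to the length of \<open>x\<close>, so
    that the inner product of \<open>y\<close> with \<open>A *v x\<close> is
    \<open>s * (x \<bullet> x)\<close>.\<close>
  define y where "y = (1 / s) *\<^sub>R (A *v x)"
  have s: "s > 0"
    using False by (simp add: s_def)
  have nx: "norm (A *v x) = s * norm x"
    using False by (simp add: s_def)
  have yy: "y \<bullet> y = x \<bullet> x"
    using s nx by (simp add: y_def power2_eq_square flip: power2_norm_eq_inner)
  have yx: "y \<bullet> (A *v x) = s * (x \<bullet> x)"
    using s nx by (simp add: y_def power2_eq_square flip: power2_norm_eq_inner)
  have "4 * (y \<bullet> (A *v x)) =
      (x + 1 *\<^sub>R y) \<bullet> (A *v (x + 1 *\<^sub>R y)) - (x + (-1) *\<^sub>R y) \<bullet> (A *v (x + (-1) *\<^sub>R y))"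
    unfolding quadratic_form_add[OF sym] by simp
  also have "\<dots> \<le> K * ((x + 1 *\<^sub>R y) \<bullet> (x + 1 *\<^sub>R y)) + K * ((x + (-1) *\<^sub>R y) \<bullet> (x + (-1) *\<^sub>R y))"
    using K[of "x + 1 *\<^sub>R y"] K[of "x + (-1) *\<^sub>R y"] by linarith
  also have "\<dots> = 4 * (K * (x \<bullet> x))"
    using yy by (simp add: inner_add_left inner_add_right inner_diff_left inner_diff_right
        inner_commute[of x y] algebra_simps)
  finally have "s * (x \<bullet> x) \<le> K * (x \<bullet> x)"
    using yx by simp
  then have "s \<le> K"
    using False by (simp add: mult_le_cancel_right)
  then show ?thesis
    unfolding nx by (simp add: mult_right_mono)
qed

section \<open>Adjacency matrix, degrees and cliques\<close>

lemma adjacency_matrix_nth [simp]: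
  "adjacency_matrix E $ i $ j = (if {i, j} \<in> E then 1 else 0)"
  by (simp add: adjacency_matrix_def)

lemma transpose_adjacency_matrix: "transpose (adjacency_matrix E) = adjacency_matrix E"
  by (simp add: transpose_def vec_eq_iff insert_commute)

lemma simple_graph_no_loop: "simple_graph E \<Longrightarrow> {i} \<notin> E"
  by (auto simp: simple_graph_def)

lemma card_le_clique_number:
  fixes K :: "'v::finite set"
  shows "clique K E \<Longrightarrow> card K \<le> clique_number E"
  unfolding clique_number_def by (rule Max_ge) auto

lemma clique_number_pos:
  fixes E :: "'v::finite set set"
  shows "clique_number E \<ge> 1"
  using card_le_clique_number[of "{undefined}" E] by (simp add: clique_def)

text \<open>Sorting ordered pairs by the edge they span, each fibre has exactly two elements,
  because an edge has two distinct ends.\<close>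

lemma sum_ordered_edges:
  fixes g :: "'v::finite set \<Rightarrow> real"
  assumes "simple_graph E"
  shows "(\<Sum>i\<in>UNIV. \<Sum>j\<in>UNIV. adjacency_matrix E $ i $ j * g {i, j}) = 2 * (\<Sum>e\<in>E. g e)"
proof -
  define P where "P = {(i, j). {i, j} \<in> E}"
  have "(\<Sum>i\<in>UNIV. \<Sum>j\<in>UNIV. adjacency_matrix E $ i $ j * g {i, j}) =
      (\<Sum>(i, j)\<in>UNIV. if {i, j} \<in> E then g {i, j} else 0)"
    by (simp add: sum.cartesian_product if_distrib[of "\<lambda>x. x * _"] cong: if_cong)
  also have "\<dots> = (\<Sum>p\<in>P. g {fst p, snd p})"
    by (rule sum.mono_neutral_cong_right) (auto simp: P_def split: if_splits)
  also have "\<dots> = (\<Sum>e\<in>E. of_nat (card {p \<in> P. {fst p, snd p} = e}) * g e)"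
    by (rule sum_fun_comp[where g = "\<lambda>p. {fst p, snd p}"]) (auto simp: P_def)
  also have "\<dots> = (\<Sum>e\<in>E. 2 * g e)"
  proof (rule sum.cong)
    fix e
    assume "e \<in> E"
    then obtain a b where ab: "e = {a, b}" "a \<noteq> b"
      using assms by (auto simp: simple_graph_def card_2_iff)
    with \<open>e \<in> E\<close> have "{p \<in> P. {fst p, snd p} = e} = {(a, b), (b, a)}"
      by (auto simp: P_def doubleton_eq_iff insert_commute)
    then show "of_nat (card {p \<in> P. {fst p, snd p} = e}) * g e = 2 * g e"
      using ab by simp
  qed simp
  finally show ?thesis
    by (simp add: sum_distrib_left)
qed

lemma degree_eq_sum:
  fixes E :: "'v::finite set set"
  assumes "simple_graph E"
  shows "real (degree E i) = (\<Sum>j\<in>UNIV. adjacency_matrix E $ i $ j)"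
proof -
  have "bij_betw (\<lambda>j. {i, j}) {j. {i, j} \<in> E} {e \<in> E. i \<in> e}"
    unfolding bij_betw_def
  proof
    show "inj_on (\<lambda>j. {i, j}) {j. {i, j} \<in> E}"
      by (auto simp: inj_on_def doubleton_eq_iff)
    show "(\<lambda>j. {i, j}) ` {j. {i, j} \<in> E} = {e \<in> E. i \<in> e}"
    proof (intro equalityI subsetI)
      fix e
      assume e: "e \<in> {e \<in> E. i \<in> e}"
      then obtain a b where "e = {a, b}"
        using assms by (auto simp: simple_graph_def card_2_iff)
      with e show "e \<in> (\<lambda>j. {i, j}) ` {j. {i, j} \<in> E}"
        by (auto simp: insert_commute)
    qed auto
  qed
  then have "degree E i = card {j. {i, j} \<in> E}"
    unfolding degree_def by (rule bij_betw_same_card[symmetric])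
  then show ?thesis
    by (simp add: sum.If_cases)
qed

lemma adjacency_matrix_mult_one:
  assumes "simple_graph E"
  shows "adjacency_matrix E *v 1 = (\<chi> i. real (degree E i))"
  using degree_eq_sum[OF assms] by (simp add: vec_eq_iff matrix_vector_mult_def)

lemma sum_degrees:
  assumes "simple_graph E"
  shows "(\<Sum>i\<in>UNIV. real (degree E i)) = 2 * real (card E)"
  using sum_ordered_edges[OF assms, of "\<lambda>_. 1"] by (simp only: degree_eq_sum[OF assms]) simp

section \<open>The Motzkin--Straus inequality and the quadratic form bound\<close>

text \<open>If the support is not a clique, the form is affine in the mass shifted between two
  non-adjacent support vertices, so all mass of one of them can be moved to the other without
  decreasing the form. On a clique the bound is Cauchy--Schwarz.\<close>

lemma motzkin_straus:
  fixes E :: "'v::finite set set" and y :: "real^'v"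
  assumes simple: "simple_graph E" and "\<And>i. y $ i \<ge> 0"
  shows "y \<bullet> (adjacency_matrix E *v y) \<le> (1 - 1 / real (clique_number E)) * (\<Sum>i\<in>UNIV. y $ i)\<^sup>2"
  using assms(2)
proof (induction "card {i. y $ i \<noteq> 0}" arbitrary: y rule: less_induct)
  case less
  let ?A = "adjacency_matrix E" and ?S = "{i. y $ i \<noteq> 0}"
  show ?case
  proof (cases "clique ?S E")
    case True
    let ?w = "real (clique_number E)"
    have w: "?w > 0"
      using clique_number_pos[of E] by simp
    \<comment> \<open>On a clique support the matrix acts as all ones minus the identity; the
      diagonal correction accounts for the missing loops.\<close>
    have eq: "?A $ i $ j * (y $ i * y $ j) = y $ i * y $ j - (if j = i then (y $ i)\<^sup>2 else 0)" for i j
      using True simple_graph_no_loop[OF simple, of i]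
      by (cases "i = j"; cases "y $ i = 0"; cases "y $ j = 0")
        (auto simp: clique_def power2_eq_square)
    have "y \<bullet> (?A *v y) = (\<Sum>i\<in>UNIV. y $ i)\<^sup>2 - (\<Sum>i\<in>UNIV. (y $ i)\<^sup>2)"
      unfolding inner_matrix_vector_sum eq
      by (simp add: sum_subtractf power2_eq_square sum_product)
    moreover have "(\<Sum>i\<in>UNIV. y $ i)\<^sup>2 \<le> ?w * (\<Sum>i\<in>UNIV. (y $ i)\<^sup>2)"
    proof -
      have "(\<Sum>i\<in>UNIV. y $ i)\<^sup>2 = (\<Sum>i\<in>?S. y $ i)\<^sup>2"
        by (intro arg_cong[where f = "\<lambda>s. s\<^sup>2"] sum.mono_neutral_right) auto
      also have "\<dots> \<le> (\<Sum>i\<in>?S. (y $ i)\<^sup>2) * real (card ?S)"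
        using sum_squared_le_sum_of_squares[of "\<lambda>i. y $ i" ?S] by (simp add: mult.commute)
      also have "\<dots> \<le> (\<Sum>i\<in>?S. (y $ i)\<^sup>2) * ?w"
        using card_le_clique_number[OF True] by (intro mult_left_mono sum_nonneg) auto
      also have "(\<Sum>i\<in>?S. (y $ i)\<^sup>2) = (\<Sum>i\<in>UNIV. (y $ i)\<^sup>2)"
        by (intro sum.mono_neutral_left) auto
      finally show ?thesis
        by (simp add: mult.commute)
    qed
    then have "(\<Sum>i\<in>UNIV. y $ i)\<^sup>2 / ?w \<le> (\<Sum>i\<in>UNIV. (y $ i)\<^sup>2)"
      using w by (simp add: pos_divide_le_eq mult.commute)
    ultimately show ?thesis
      by (simp add: left_diff_distrib)
  next
    case False
    then obtain a b where ab: "y $ a \<noteq> 0" "y $ b \<noteq> 0" "a \<noteq> b" "{a, b} \<notin> E"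
      unfolding clique_def by blast
    \<comment> \<open>The pair is oriented so that moving mass from \<open>j\<close> to
      \<open>i\<close> does not decrease the form to first order.\<close>
    obtain i j where ij: "y $ i \<noteq> 0" "y $ j \<noteq> 0" "i \<noteq> j" "{i, j} \<notin> E"
      "(?A *v y) $ j \<le> (?A *v y) $ i"
    proof (cases "(?A *v y) $ b \<le> (?A *v y) $ a")
      case True
      then show ?thesis
        using ab that by blast
    next
      case False
      then show ?thesis
        using ab that[of b a] by (simp add: insert_commute)
    qed
    define d where "d = (axis i 1 - axis j 1 :: real^'v)"
    define z where "z = y + (y $ j) *\<^sub>R d"
    have d_nth: "d $ k = (if k = i then 1 else if k = j then -1 else 0)" for k
      using ij by (simp add: d_def axis_def)
    have z_nth: "z $ k = (if k = i then y $ i + y $ j else if k = j then 0 else y $ k)" for k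
      by (simp add: z_def d_nth)
    \<comment> \<open>Non-adjacency of \<open>i\<close> and \<open>j\<close> and the absence of
      loops kill the quadratic term, so only the nonnegative linear term remains. The shift by
      \<open>y $ j\<close> removes \<open>j\<close> from the support, which drives the
      induction.\<close>
    have "d \<bullet> (?A *v d) = 0"
      using ij simple_graph_no_loop[OF simple]
      by (simp add: d_def matrix_vector_mult_diff_distrib inner_diff_left inner_axis'
          matrix_vector_mult_basis column_def insert_commute)
    moreover have "d \<bullet> (?A *v y) \<ge> 0"
      using ij by (simp add: d_def inner_diff_left inner_axis')
    ultimately have "y \<bullet> (?A *v y) \<le> z \<bullet> (?A *v z)"
      using less.prems[of j]
      unfolding z_def quadratic_form_add[OF transpose_adjacency_matrix] by simp
    also have "\<dots> \<le> (1 - 1 / real (clique_number E)) * (\<Sum>k\<in>UNIV. z $ k)\<^sup>2"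
    proof (rule less.hyps)
      have "{k. z $ k \<noteq> 0} \<subset> ?S"
        using ij by (auto simp: z_nth split: if_splits)
      then show "card {k. z $ k \<noteq> 0} < card ?S"
        by (simp add: psubset_card_mono)
      show "z $ k \<ge> 0" for k
        using less.prems by (simp add: z_nth)
    qed
    also have "(\<Sum>k\<in>UNIV. z $ k) = (\<Sum>k\<in>UNIV. y $ k)"
    proof -
      have "(\<Sum>k\<in>UNIV. d $ k) = 0"
        by (simp add: d_def sum_subtractf axis_def)
      then show ?thesis
        by (simp add: z_def sum.distrib sum_distrib_left[symmetric])
    qed
    finally show ?thesis .
  qed
qed

text \<open>Cauchy--Schwarz over ordered pairs. As the matrix entries are 0 or 1 they equal their
  squares, so one factor sums to \<open>2 * real (card E)\<close> and the other is the form at the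
  vector of squares, where Motzkin--Straus applies.\<close>

lemma adjacency_quadratic_form_bound:
  fixes E :: "'v::finite set set" and x :: "real^'v"
  assumes simple: "simple_graph E"
  shows "(x \<bullet> (adjacency_matrix E *v x))\<^sup>2 \<le>
    2 * real (card E) * (1 - 1 / real (clique_number E)) * (x \<bullet> x)\<^sup>2"
proof -
  let ?A = "adjacency_matrix E"
  define y :: "real^'v" where "y = (\<chi> i. (x $ i)\<^sup>2)"
  define a where "a p = ?A $ fst p $ snd p" for p :: "'v \<times> 'v"
  define b where "b p = ?A $ fst p $ snd p * (x $ fst p * x $ snd p)" for p :: "'v \<times> 'v"
  have "x \<bullet> (?A *v x) = (\<Sum>p\<in>UNIV. a p * b p)"
    unfolding inner_matrix_vector_sum sum.cartesian_product a_def b_def UNIV_Times_UNIV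
    by (rule sum.cong) auto
  moreover have "(\<Sum>p\<in>UNIV. (a p)\<^sup>2) = 2 * real (card E)"
  proof -
    have "(\<Sum>p\<in>UNIV. (a p)\<^sup>2) = (\<Sum>i\<in>UNIV. \<Sum>j\<in>UNIV. ?A $ i $ j * 1)"
      unfolding sum.cartesian_product a_def UNIV_Times_UNIV by (rule sum.cong) auto
    then show ?thesis
      using sum_ordered_edges[OF simple, of "\<lambda>_. 1"] by simp
  qed
  moreover have "(\<Sum>p\<in>UNIV. (b p)\<^sup>2) = y \<bullet> (?A *v y)"
    unfolding inner_matrix_vector_sum sum.cartesian_product b_def y_def UNIV_Times_UNIV
    by (rule sum.cong) (auto simp: power_mult_distrib)
  ultimately have "(x \<bullet> (?A *v x))\<^sup>2 \<le> 2 * real (card E) * (y \<bullet> (?A *v y))"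
    using Cauchy_Schwarz_ineq_sum[of a b UNIV] by simp
  also have "\<dots> \<le> 2 * real (card E) * ((1 - 1 / real (clique_number E)) * (\<Sum>i\<in>UNIV. y $ i)\<^sup>2)"
    using motzkin_straus[OF simple, of y] by (intro mult_left_mono) (auto simp: y_def)
  also have "(\<Sum>i\<in>UNIV. y $ i) = x \<bullet> x"
    by (simp add: y_def inner_vec_def power2_eq_square)
  finally show ?thesis
    by (simp add: mult.assoc)
qed

text \<open>The eigenvalue dominating the Rayleigh quotient shows that the maximum is over a
  nonempty set, and it is positive since the form at the all-ones vector is twice the number of
  edges.\<close>

lemma largest_eigenvalue_adjacency:
  fixes E :: "'v::finite set set"
  assumes simple: "simple_graph E" and edge: "card E \<ge> 1"
  shows "largest_eigenvalue E > 0" and "eigenvalue (adjacency_matrix E) (largest_eigenvalue E)"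
proof -
  let ?A = "adjacency_matrix E"
  note fin = finite_eigenvalues[OF transpose_adjacency_matrix, of E]
  obtain c where c: "eigenvalue ?A c" "\<And>x. x \<bullet> (?A *v x) \<le> c * (x \<bullet> x)"
    using eigenvalue_bounding_quadratic_form[OF transpose_adjacency_matrix] by blast
  have "0 < 2 * real (card E)"
    using edge by simp
  also have "\<dots> = 1 \<bullet> (?A *v 1)"
    using sum_degrees[OF simple]
    by (simp add: adjacency_matrix_mult_one[OF simple] inner_vec_def)
  also have "\<dots> \<le> c * ((1 :: real^'v) \<bullet> 1)"
    by (rule c)
  finally have "c > 0"
    by (metis inner_ge_zero linorder_not_less mult_nonpos_nonneg)
  moreover have "c \<le> largest_eigenvalue E"
    unfolding largest_eigenvalue_def using c(1) fin by (intro Max_ge) auto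
  ultimately show "largest_eigenvalue E > 0"
    by simp
  have "largest_eigenvalue E \<in> {c. eigenvalue ?A c}"
    unfolding largest_eigenvalue_def using c(1) fin by (intro Max_in) auto
  then show "eigenvalue ?A (largest_eigenvalue E)"
    by simp
qed

section \<open>The three edge bounds\<close>

theorem theorem3:
  fixes E :: "'v::finite set set"
  assumes "simple_graph E"
    and "card E \<ge> 1"
  shows "2 * real (card E) \<le>
           (real (clique_number E) - 1) * (real CARD('v))\<^sup>2 / (real (clique_number E) * (beta E)\<^sup>2) \<and>
         2 * real (card E) \<le>
           (real (clique_number E) - 1) * (real CARD('v))\<^sup>2 / (real (clique_number E) * nu E) \<and>
         2 * real (card E) \<le>
           (real (clique_number E) - 1) * (real CARD('v))\<^sup>2 / (real (clique_number E) * (epsilon E)\<^sup>2)"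
proof -
  let ?A = "adjacency_matrix E"
  define m where "m = real (card E)"
  define n where "n = real CARD('v)"
  define w where "w = real (clique_number E)"
  define K where "K = sqrt (2 * m * (1 - 1 / w))"
  have pos: "m > 0" "n > 0" "w \<ge> 1"
    using assms(2) clique_number_pos[of E] by (auto simp: m_def n_def w_def)
  have K2: "K\<^sup>2 = 2 * m * (1 - 1 / w)" and "K \<ge> 0"
    using pos by (simp_all add: K_def)
  have form_le: "\<bar>x \<bullet> (?A *v x)\<bar> \<le> K * (x \<bullet> x)" for x
  proof -
    have "\<bar>x \<bullet> (?A *v x)\<bar>\<^sup>2 \<le> (K * (x \<bullet> x))\<^sup>2"
      using adjacency_quadratic_form_bound[OF assms(1), of x]
      by (simp add: power_mult_distrib K2 m_def w_def)
    then show ?thesis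
      using \<open>K \<ge> 0\<close> by (simp add: abs_le_square_iff[symmetric])
  qed
  \<comment> \<open>Here \<open>r\<close> stands for the square of \<open>beta E\<close>, for
    \<open>nu E\<close>, or for the square of \<open>epsilon E\<close>; multiplying
    \<open>K\<^sup>2\<close> by \<open>w\<close> clears its denominator, and a common factor
    \<open>2 * m\<close> cancels.\<close>
  have main: "2 * m \<le> (w - 1) * n\<^sup>2 / (w * r)" if "r > 0" "4 * m\<^sup>2 * r \<le> n\<^sup>2 * K\<^sup>2" for r
  proof -
    have "2 * m * (2 * m * (w * r)) = w * (4 * m\<^sup>2 * r)"
      by (simp add: power2_eq_square)
    also have "\<dots> \<le> w * (n\<^sup>2 * K\<^sup>2)"
      using that pos by (intro mult_left_mono) auto
    also have "\<dots> = 2 * m * ((w - 1) * n\<^sup>2)"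
      using pos by (simp add: K2 field_simps)
    finally have "2 * m * (w * r) \<le> (w - 1) * n\<^sup>2"
      by (rule mult_left_le_imp_le) (use pos in simp)
    then show ?thesis
      using that pos by (simp add: pos_le_divide_eq)
  qed

  have beta: "beta E = largest_eigenvalue E * n / (2 * m)"
    by (simp add: beta_def m_def n_def)
  obtain x where x: "x \<noteq> 0" "?A *v x = largest_eigenvalue E *\<^sub>R x"
    using largest_eigenvalue_adjacency(2)[OF assms] by (auto simp: eigenvalue_def)
  have "largest_eigenvalue E * (x \<bullet> x) \<le> K * (x \<bullet> x)"
    using form_le[of x] x(2) by simp
  then have "largest_eigenvalue E \<le> K"
    by (rule mult_right_le_imp_le) (use x(1) in simp)
  then have "(largest_eigenvalue E)\<^sup>2 \<le> K\<^sup>2"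
    using largest_eigenvalue_adjacency(1)[OF assms] by (intro power_mono) auto
  then have "4 * m\<^sup>2 * (beta E)\<^sup>2 \<le> n\<^sup>2 * K\<^sup>2"
    using pos by (simp add: beta power_divide power_mult_distrib)
  moreover have "beta E > 0"
    using pos largest_eigenvalue_adjacency(1)[OF assms] by (simp add: beta)
  ultimately have 1: "2 * m \<le> (w - 1) * n\<^sup>2 / (w * (beta E)\<^sup>2)"
    by (intro main) auto

  define D where "D = (\<Sum>i\<in>UNIV. (real (degree E i))\<^sup>2)"
  have nu: "nu E = n * D / (4 * m\<^sup>2)"
    by (simp add: nu_def m_def n_def D_def)
  have one: "(norm (1 :: real^'v))\<^sup>2 = n"
    unfolding power2_norm_eq_inner by (simp add: inner_vec_def n_def)
  have D: "(norm (?A *v 1))\<^sup>2 = D"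
    unfolding power2_norm_eq_inner adjacency_matrix_mult_one[OF assms(1)]
    by (simp add: inner_vec_def D_def power2_eq_square)
  have "(norm (?A *v 1))\<^sup>2 \<le> (K * norm (1 :: real^'v))\<^sup>2"
    using norm_matrix_vector_le_if_quadratic_form_le[OF transpose_adjacency_matrix form_le]
    by (intro power_mono) auto
  then have "D \<le> K\<^sup>2 * n"
    by (simp add: D power_mult_distrib one)
  then have "4 * m\<^sup>2 * nu E \<le> n\<^sup>2 * K\<^sup>2"
    using pos by (simp add: nu power2_eq_square mult.commute mult.left_commute)
  moreover have "nu E > 0"
  proof -
    have "?A *v 1 \<noteq> 0"
    proof
      assume "?A *v 1 = 0"
      then have "degree E i = 0" for i
        using adjacency_matrix_mult_one[OF assms(1)] by (simp add: vec_eq_iff)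
      then show False
        using sum_degrees[OF assms(1)] assms(2) by simp
    qed
    then have "D > 0"
      by (simp flip: D)
    then show ?thesis
      using pos by (simp add: nu)
  qed
  ultimately have 2: "2 * m \<le> (w - 1) * n\<^sup>2 / (w * nu E)"
    by (intro main)

  define S where "S = (\<Sum>e\<in>E. sqrt (\<Prod>i\<in>e. real (degree E i)))"
  define z :: "real^'v" where "z = (\<chi> i. sqrt (real (degree E i)))"
  have eps: "epsilon E = n * S / (2 * m\<^sup>2)"
    by (simp add: epsilon_def m_def n_def S_def)
  have "z \<bullet> (?A *v z) =
      (\<Sum>i\<in>UNIV. \<Sum>j\<in>UNIV. ?A $ i $ j * sqrt (\<Prod>k\<in>{i, j}. real (degree E k)))"
    unfolding inner_matrix_vector_sum
  proof (intro sum.cong refl)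
    fix i j :: 'v
    show "?A $ i $ j * (z $ i * z $ j) = ?A $ i $ j * sqrt (\<Prod>k\<in>{i, j}. real (degree E k))"
      \<comment> \<open>For \<open>i = j\<close> the set \<open>{i, j}\<close> is a singleton and
        the product has only one factor, but the matrix entry is then zero.\<close>
      using simple_graph_no_loop[OF assms(1), of i]
      by (cases "i = j") (simp_all add: z_def real_sqrt_mult)
  qed
  then have zAz: "z \<bullet> (?A *v z) = 2 * S"
    using sum_ordered_edges[OF assms(1)] by (simp add: S_def)
  have zz: "z \<bullet> z = 2 * m"
    using sum_degrees[OF assms(1)] by (simp add: z_def inner_vec_def m_def)
  have "S > 0"
    unfolding S_def
  proof (rule sum_pos)
    show "E \<noteq> {}"
      using assms(2) by auto
    fix e
    assume "e \<in> E"
    then have "degree E i > 0" if "i \<in> e" for i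
      using that unfolding degree_def by (auto simp: card_gt_0_iff)
    then show "sqrt (\<Prod>i\<in>e. real (degree E i)) > 0"
      by (auto intro!: prod_pos)
  qed simp
  moreover have "S \<le> K * m"
    using form_le[of z] by (simp add: zAz zz)
  ultimately have "S\<^sup>2 \<le> (K * m)\<^sup>2"
    by (intro power_mono) auto
  then have "n\<^sup>2 * S\<^sup>2 \<le> n\<^sup>2 * (K * m)\<^sup>2"
    by (intro mult_left_mono) auto
  \<comment> \<open>The extra \<open>m\<^sup>2\<close> clears the denominator
    \<open>4 * m ^ 4\<close> of the squared \<open>epsilon E\<close>; it is cancelled again
    below.\<close>
  moreover have "4 * m\<^sup>2 * (epsilon E)\<^sup>2 * m\<^sup>2 = n\<^sup>2 * S\<^sup>2"
    using pos by (simp add: eps power2_eq_square)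
  ultimately have "4 * m\<^sup>2 * (epsilon E)\<^sup>2 * m\<^sup>2 \<le> n\<^sup>2 * K\<^sup>2 * m\<^sup>2"
    by (simp add: power_mult_distrib mult.assoc)
  then have "4 * m\<^sup>2 * (epsilon E)\<^sup>2 \<le> n\<^sup>2 * K\<^sup>2"
    by (rule mult_right_le_imp_le) (use pos in simp)
  moreover have "epsilon E > 0"
    using pos \<open>S > 0\<close> by (simp add: eps)
  ultimately have 3: "2 * m \<le> (w - 1) * n\<^sup>2 / (w * (epsilon E)\<^sup>2)"
    by (intro main) auto

  show ?thesis
    using 1 2 3 unfolding m_def n_def w_def by blast
qed

end
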